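(* Let $\alpha\geq\aleph_{0}$ be a cardinal number and let $V$ be an $F$-space over $\mathbb{K}$. Let $A$, $B$ be subsets of $V$ such that $A$ is $\alpha$-lineable and $B$ is $1$-lineable. If $A\cap B=\varnothing$ and $A$ is stronger than $B$, then $A$ is not $(\alpha,\beta)$-spaceable in $V$, for any cardinal number $\beta\geq\alpha$.
   Context: $\mathbb{K}$ denotes $\mathbb{R}$ or $\mathbb{C}$; dimension means algebraic (Hamel) dimension. An $F$-space is a topological vector space whose topology can be defined by a complete translation-invariant metric. For subsets $A,B$ of a vector space, $A$ is called stronger than $B$ if $A+B\subset A$. A subset $A$ of a vector space $V$ is $\alpha$-lineable if $A\cup\{0\}$ contains an $\alpha$-dimensional vector subspace of $V$. For cardinals $\alpha\le\beta$ and $V$ endowed with a topology, a non-void subset $A\subset V$ is $(\alpha,\beta)$-spaceable if it is $\alpha$-lineable and for each $\alpha$-dimensional subspace $W_\alpha\subset A\cup\{0\}$ there is a closed $\beta$-dimensional subspace $W_\beta$ of $V$ with $W_\alpha\subset W_\beta\subset A\cup\{0\}$. *)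

theory Defs
  imports "HOL-Analysis.Analysis"
begin

unbundle cardinal_syntax

text \<open>
  A vector space over a field \<open>'k\<close> is given by its scalar multiplication \<open>scl\<close>; its
  carrier is the whole type \<open>'v\<close>. Scalars range over the class \<^class>\<open>real_normed_field\<close>,
  whose instances include \<^typ>\<open>real\<close> and \<^typ>\<open>complex\<close>; by the Gelfand--Mazur theorem every
  instance is isometrically isomorphic to one of these two.

  Cardinals are cardinal orders, and the dimension is the Hamel dimension as such a cardinal
  (the library's \<open>dim\<close> is a natural number and only meaningful in finite dimension).
\<close>

definition F_space :: "('k::real_normed_field \<Rightarrow> 'v::topological_ab_group_add \<Rightarrow> 'v) \<Rightarrow> bool" where
  "F_space scl \<longleftrightarrow>
     vector_space scl \<and>
     continuous_on UNIV (\<lambda>(c, x). scl c x) \<and>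
     (\<exists>d. Metric_space UNIV d \<and>
          (\<forall>x y z. d (x + z) (y + z) = d x y) \<and>
          Metric_space.mcomplete UNIV d \<and>
          Metric_space.mtopology UNIV d = (euclidean :: 'v topology))"

definition subspace_of_dim ::
    "('k::field \<Rightarrow> 'v::ab_group_add \<Rightarrow> 'v) \<Rightarrow> 'c rel \<Rightarrow> 'v set \<Rightarrow> bool" where
  "subspace_of_dim scl \<alpha> W \<longleftrightarrow>
     module.subspace scl W \<and>
     (\<exists>E. \<not> module.dependent scl E \<and> module.span scl E = W \<and> |E| =o \<alpha>)"

definition stronger :: "'v::ab_group_add set \<Rightarrow> 'v set \<Rightarrow> bool" where
  "stronger A B \<longleftrightarrow> A + B \<subseteq> A"

definition lineable ::
    "('k::field \<Rightarrow> 'v::ab_group_add \<Rightarrow> 'v) \<Rightarrow> 'c rel \<Rightarrow> 'v set \<Rightarrow> bool" where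
  "lineable scl \<alpha> A \<longleftrightarrow> (\<exists>W. subspace_of_dim scl \<alpha> W \<and> W \<subseteq> A \<union> {0})"

definition spaceable ::
    "('k::field \<Rightarrow> 'v::{ab_group_add, topological_space} \<Rightarrow> 'v) \<Rightarrow> 'c rel \<Rightarrow> 'd rel \<Rightarrow> 'v set \<Rightarrow> bool"
  where
  "spaceable scl \<alpha> \<beta> A \<longleftrightarrow>
     A \<noteq> {} \<and>
     lineable scl \<alpha> A \<and>
     (\<forall>W. subspace_of_dim scl \<alpha> W \<and> W \<subseteq> A \<union> {0} \<longrightarrow>
        (\<exists>W'. closed W' \<and> subspace_of_dim scl \<beta> W' \<and> W \<subseteq> W' \<and> W' \<subseteq> A \<union> {0}))"

end

theory Submission imports Defs
begin

text \<open>
  Let \<open>W \<subseteq> A \<union> {0}\<close> be a subspace with Hamel basis \<open>E\<close> of cardinality \<open>\<alpha>\<close>, and let \<open>b \<noteq> 0\<close> span a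
  line inside \<open>B \<union> {0}\<close>. The theorem holds because \<open>W\<close> can be tilted in the direction of \<open>b\<close>, without
  leaving \<open>A \<union> {0}\<close>, so violently that \<open>b\<close> becomes a limit point.

  For a linear functional \<open>f\<close> consider \<open>T w = w + f(w) b\<close>. As \<open>A\<close> is stronger than \<open>B\<close>, the map \<open>T\<close>
  sends \<open>W\<close> into \<open>A \<union> {0}\<close>; as \<open>A\<close> and \<open>B\<close> are disjoint, \<open>W\<close> meets the line of \<open>b\<close> only in \<open>0\<close>, so
  \<open>T\<close> is injective on \<open>W\<close> and preserves the dimension \<open>\<alpha>\<close>
  (\<open>tilted_subspace_of_dim\<close>, \<open>tilted_subset\<close>).

  Since \<open>\<alpha>\<close> is infinite, \<open>E\<close> contains a sequence of distinct vectors \<open>e\<^sub>n\<close>. Scalar multiplication is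
  continuous and the topology has a countable base at \<open>0\<close>, so there are scalars \<open>r\<^sub>n \<noteq> 0\<close> with
  \<open>r\<^sub>n e\<^sub>n \<longrightarrow> 0\<close>. Independence of the \<open>e\<^sub>n\<close> permits \<open>f(e\<^sub>n) = 1/r\<^sub>n\<close>, and then
  \<open>r\<^sub>n T(e\<^sub>n) = r\<^sub>n e\<^sub>n + b \<longrightarrow> b\<close> (\<open>exists_functional_tilting_to_limit\<close>). Hence every closed subspace
  containing \<open>T(W)\<close> contains \<open>b\<close>, a nonzero vector of \<open>B\<close> and so not of \<open>A\<close>: the \<open>\<alpha>\<close>-dimensional
  space \<open>T(W)\<close> has no closed extension inside \<open>A \<union> {0}\<close>, of whatever dimension.
\<close>

lemma F_space_countable_base_at_zero:
  fixes scl :: "'k::real_normed_field \<Rightarrow> 'v::topological_ab_group_add \<Rightarrow> 'v"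
  assumes "F_space scl"
  obtains U :: "nat \<Rightarrow> 'v set"
  where "\<And>n. open (U n)" "\<And>n. 0 \<in> U n" "\<And>S. \<lbrakk>open S; 0 \<in> S\<rbrakk> \<Longrightarrow> \<exists>n. U n \<subseteq> S"
proof -
  obtain d where d: "Metric_space UNIV d"
    and top: "Metric_space.mtopology UNIV d = (euclidean :: 'v topology)"
    using assms unfolding F_space_def by blast
  interpret Metric_space UNIV d by (fact d)
  show thesis
  proof
    fix n :: nat
    show "open (mball 0 (inverse (Suc n)))"
      by (metis openin_mball open_openin top)
    show "0 \<in> mball 0 (inverse (Suc n))" by simp
  next
    fix S :: "'v set" assume "open S" "0 \<in> S"
    then obtain r where "r > 0" and r: "mball 0 r \<subseteq> S"
      by (metis open_openin openin_mtopology top)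
    obtain n where "inverse (real (Suc n)) < r"
      using reals_Archimedean \<open>r > 0\<close> by blast
    with r show "\<exists>n. mball 0 (inverse (real (Suc n))) \<subseteq> S"
      by (meson less_imp_le mball_subset_concentric subset_trans)
  qed
qed

lemma exists_nonzero_scaling_into_nbhd:
  fixes scl :: "'k::real_normed_field \<Rightarrow> 'v::topological_ab_group_add \<Rightarrow> 'v"
  assumes "vector_space scl" and cont: "continuous_on UNIV (\<lambda>(c, x). scl c x)"
    and "open U" "0 \<in> U"
  shows "\<exists>r. r \<noteq> 0 \<and> scl r x \<in> U"
proof -
  interpret vector_space scl by fact
  have "continuous_on UNIV (\<lambda>c. scl c x)"
    using continuous_on_compose2[OF cont, of UNIV "\<lambda>c. (c, x)"] by (simp add: continuous_intros)
  then have "open ((\<lambda>c. scl c x) -` U)"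
    using \<open>open U\<close> by (simp add: continuous_on_open_vimage)
  moreover have "0 \<in> (\<lambda>c. scl c x) -` U" using \<open>0 \<in> U\<close> by simp
  ultimately obtain e where "e > 0" and e: "ball 0 e \<subseteq> (\<lambda>c. scl c x) -` U"
    by (meson open_contains_ball)
  then have "of_real (e / 2) \<in> (\<lambda>c. scl c x) -` U"
    by (intro subsetD[OF e]) (simp add: norm_divide)
  with \<open>e > 0\<close> show ?thesis by (intro exI[of _ "of_real (e / 2)"]) auto
qed

lemma linear_tilt:
  fixes scl :: "'k::field \<Rightarrow> 'v::ab_group_add \<Rightarrow> 'v"
  assumes "Vector_Spaces.linear scl (*) f"
  shows "Vector_Spaces.linear scl scl (\<lambda>w. w + scl (f w) b)"
proof -
  interpret f: Vector_Spaces.linear scl "(*)" f by fact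
  show ?thesis
    by unfold_locales (simp_all add: f.add f.scale f.vs1.scale_left_distrib f.vs1.scale_right_distrib)
qed

text \<open>
  A kernel vector \<open>w\<close> of the tilt lies on the line of \<open>b\<close>; if that line meets \<open>W\<close> only in \<open>0\<close>, then
  \<open>w = 0\<close>. So the tilt carries a basis of \<open>W\<close> bijectively onto a basis of its image.
\<close>

lemma tilted_subspace_of_dim:
  fixes scl :: "'k::field \<Rightarrow> 'v::ab_group_add \<Rightarrow> 'v"
  assumes f: "Vector_Spaces.linear scl (*) f"
    and W: "subspace_of_dim scl \<alpha> W"
    and trivial_Int: "\<And>t. scl t b \<in> W \<Longrightarrow> scl t b = 0"
  shows "subspace_of_dim scl \<alpha> ((\<lambda>w. w + scl (f w) b) ` W)"
proof -
  let ?T = "\<lambda>w. w + scl (f w) b"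
  interpret T: Vector_Spaces.linear scl scl ?T using f by (rule linear_tilt)
  interpret P: vector_space_pair scl scl by unfold_locales
  from W obtain E where sub: "T.vs1.subspace W" and indep: "\<not> T.vs1.dependent E"
    and span: "T.vs1.span E = W" and card: "|E| =o \<alpha>"
    unfolding subspace_of_dim_def by blast
  have kernel: "w = 0" if "w \<in> W" "?T w = 0" for w
  proof -
    have w: "w = scl (- f w) b" using that(2) by (simp add: eq_neg_iff_add_eq_0)
    then show ?thesis using trivial_Int that(1) by metis
  qed
  have inj: "inj_on ?T W"
    using T.inj_on_iff_eq_0[OF sub] kernel by blast
  have "\<not> T.vs1.dependent (?T ` E)"
    using P.linear_independent_injective_image[OF T.linear_axioms indep] inj span by blast
  moreover have "T.vs1.span (?T ` E) = ?T ` W"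
    using T.span_image[of E] span by simp
  moreover have "|?T ` E| =o \<alpha>"
  proof -
    have "inj_on ?T E" using inj inj_on_subset T.vs1.span_superset span by metis
    then have "|?T ` E| =o |E|"
      by (rule ordIso_symmetric[OF card_of_ordIsoI, OF inj_on_imp_bij_betw])
    then show ?thesis using card by (rule ordIso_transitive)
  qed
  ultimately show ?thesis
    unfolding subspace_of_dim_def using T.subspace_image[OF sub] by blast
qed

lemma tilted_subset:
  fixes scl :: "'k::field \<Rightarrow> 'v::ab_group_add \<Rightarrow> 'v"
  assumes "Vector_Spaces.linear scl (*) f"
    and "stronger A B" and "W \<subseteq> A \<union> {0}"
    and line: "\<And>t. scl t b \<in> B \<union> {0}"
  shows "(\<lambda>w. w + scl (f w) b) ` W \<subseteq> A \<union> {0}"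
proof (rule image_subsetI)
  fix w assume "w \<in> W"
  interpret f: Vector_Spaces.linear scl "(*)" f by fact
  show "w + scl (f w) b \<in> A \<union> {0}"
  proof (cases "w = 0")
    case True
    then show ?thesis by simp
  next
    case False
    then have "w \<in> A" using \<open>w \<in> W\<close> \<open>W \<subseteq> A \<union> {0}\<close> by blast
    consider "scl (f w) b = 0" | "scl (f w) b \<in> B" using line by blast
    then show ?thesis
    proof cases
      case 1
      with \<open>w \<in> A\<close> show ?thesis by (metis UnI1 add_0_right)
    next
      case 2
      then have "w + scl (f w) b \<in> A + B" using \<open>w \<in> A\<close> by (intro set_plus_intro)
      then show ?thesis using \<open>stronger A B\<close> unfolding stronger_def by blast
    qed
  qed
qed

text \<open>
  The steeper the tilt along vectors that can be scaled down to \<open>0\<close>, the closer the tilted space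
  comes to \<open>b\<close>; an independent sequence lets the slope grow as fast as required.
\<close>

lemma exists_functional_tilting_to_limit:
  fixes scl :: "'k::real_normed_field \<Rightarrow> 'v::topological_ab_group_add \<Rightarrow> 'v"
  assumes F: "F_space scl"
    and indep: "\<not> module.dependent scl E" and "infinite E"
  obtains f where "Vector_Spaces.linear scl (*) f"
    and "\<And>C. \<lbrakk>closed C; module.subspace scl C; (\<lambda>w. w + scl (f w) b) ` E \<subseteq> C\<rbrakk> \<Longrightarrow> b \<in> C"
proof -
  have vs: "vector_space scl" and cont: "continuous_on UNIV (\<lambda>(c, x). scl c x)"
    using F unfolding F_space_def by blast+
  interpret vector_space scl by (fact vs)
  interpret K: vector_space "(*) :: 'k \<Rightarrow> 'k \<Rightarrow> 'k"
    by unfold_locales (simp_all add: algebra_simps)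
  interpret P: vector_space_pair scl "(*) :: 'k \<Rightarrow> 'k \<Rightarrow> 'k" by unfold_locales
  obtain e :: "nat \<Rightarrow> 'v" where "inj e" and e: "range e \<subseteq> E"
    using \<open>infinite E\<close> infinite_countable_subset by blast
  obtain U :: "nat \<Rightarrow> 'v set" where U: "\<And>n. open (U n)" "\<And>n. 0 \<in> U n"
    and base: "\<And>S. \<lbrakk>open S; 0 \<in> S\<rbrakk> \<Longrightarrow> \<exists>n. U n \<subseteq> S"
    using F_space_countable_base_at_zero[OF F] by metis
  have "\<forall>n. \<exists>r. r \<noteq> 0 \<and> scl r (e n) \<in> U n"
    using exists_nonzero_scaling_into_nbhd[OF vs cont] U by blast
  then obtain r where r0: "\<And>n. r n \<noteq> 0" and r: "\<And>n. scl (r n) (e n) \<in> U n" by metis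
  obtain f where lin: "Vector_Spaces.linear scl (*) f"
    and f: "\<forall>x\<in>E. f x = inverse (r (inv e x))"
    using P.linear_independent_extend[OF indep, of "\<lambda>x. inverse (r (inv e x))"] by blast
  have fe: "f (e n) = inverse (r n)" for n
    using f e \<open>inj e\<close> by (simp add: range_subsetD)
  show thesis
  proof (rule that[OF lin])
    fix C :: "'v set"
    assume "closed C" and sub: "subspace C" and TE: "(\<lambda>w. w + scl (f w) b) ` E \<subseteq> C"
    show "b \<in> C"
    proof (rule ccontr)
      assume "b \<notin> C"
      have "open ((\<lambda>v. v + b) -` (- C))"
        using \<open>closed C\<close> by (intro open_vimage open_Compl continuous_intros)
      then obtain n where "U n \<subseteq> (\<lambda>v. v + b) -` (- C)"
        using base \<open>b \<notin> C\<close> by fastforce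
      then have "scl (r n) (e n) + b \<notin> C" using r by blast
      moreover have "scl (r n) (e n + scl (f (e n)) b) \<in> C"
        using TE e by (intro subspace_scale[OF sub]) blast
      ultimately show False
        by (simp add: fe scale_right_distrib r0)
    qed
  qed
qed

theorem theorem2p1:
  fixes scl :: "'k::real_normed_field \<Rightarrow> 'v::topological_ab_group_add \<Rightarrow> 'v"
    and A B :: "'v set"
    and \<alpha> :: "'c rel"
    and \<beta> :: "'d rel"
  assumes "Card_order \<alpha>" and "natLeq \<le>o \<alpha>"
    and "F_space scl"
    and "lineable scl \<alpha> A"
    and "lineable scl |{()}| B"
    and "A \<inter> B = {}"
    and "stronger A B"
    and "Card_order \<beta>" and "\<alpha> \<le>o \<beta>"
  shows "\<not> spaceable scl \<alpha> \<beta> A"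
proof
  assume spaceable: "spaceable scl \<alpha> \<beta> A"
  interpret vector_space scl using \<open>F_space scl\<close> unfolding F_space_def by blast
  obtain W E where W: "subspace_of_dim scl \<alpha> W" "W \<subseteq> A \<union> {0}"
    and E: "\<not> dependent E" "span E = W" "|E| =o \<alpha>"
    using \<open>lineable scl \<alpha> A\<close> unfolding lineable_def subspace_of_dim_def by blast
  have "infinite E"
    using ordLeq_ordIso_trans[OF \<open>natLeq \<le>o \<alpha>\<close> ordIso_symmetric[OF E(3)]]
    using infinite_iff_natLeq_ordLeq by blast
  obtain L G where L: "L \<subseteq> B \<union> {0}"
    and G: "\<not> dependent G" "span G = L" "|G| =o |{()}|"
    using \<open>lineable scl |{()}| B\<close> unfolding lineable_def subspace_of_dim_def by blast
  have "G \<noteq> {}" using card_of_empty2[OF ordIso_symmetric] G(3) by blast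
  then obtain b where "b \<in> G" by blast
  then have "b \<noteq> 0" using G(1) dependent_zero by blast
  have line: "scl t b \<in> B \<union> {0}" for t
    using L G(2) \<open>b \<in> G\<close> span_scale span_base by blast
  have "b \<in> B" using line[of 1] \<open>b \<noteq> 0\<close> by simp
  obtain f where f: "Vector_Spaces.linear scl (*) f"
    and limit: "\<And>C. \<lbrakk>closed C; subspace C; (\<lambda>w. w + scl (f w) b) ` E \<subseteq> C\<rbrakk> \<Longrightarrow> b \<in> C"
    using exists_functional_tilting_to_limit[OF \<open>F_space scl\<close> E(1) \<open>infinite E\<close>, of b] by metis
  let ?W = "(\<lambda>w. w + scl (f w) b) ` W"
  have "scl t b = 0" if "scl t b \<in> W" for t
    using that line[of t] W(2) \<open>A \<inter> B = {}\<close> by blast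
  then have "subspace_of_dim scl \<alpha> ?W" by (rule tilted_subspace_of_dim[OF f W(1)])
  moreover have "?W \<subseteq> A \<union> {0}" using f \<open>stronger A B\<close> W(2) line by (rule tilted_subset)
  ultimately obtain C where C: "closed C" "subspace_of_dim scl \<beta> C" "?W \<subseteq> C" "C \<subseteq> A \<union> {0}"
    using spaceable unfolding spaceable_def by meson
  have "b \<in> C"
  proof (rule limit)
    show "subspace C" using C(2) unfolding subspace_of_dim_def by blast
    show "(\<lambda>w. w + scl (f w) b) ` E \<subseteq> C" using C(3) E(2) span_superset by blast
  qed (fact C(1))
  with C(4) \<open>b \<in> B\<close> \<open>b \<noteq> 0\<close> \<open>A \<inter> B = {}\<close> show False by blast
qed

end
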